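(* If $\star$ is any nucleus on a precoherent semiprequantale $Q$, then there is a largest finitary nucleus $\star_f$ on $Q$ that is smaller than $\star$, and one has $$x^{\star_f} = \bigvee\{y^\star : y \in \mathsf{K}(Q) \text{ and } y \leq x\}$$ for all $x \in Q$.
   Context: An ordered magma is a set $M$ with a binary operation (written multiplicatively) and a partial order such that $x\le x'$, $y \le y'$ imply $xy \le x'y'$. A semiprequantale is an ordered magma $Q$ such that $\bigvee X$ exists and $a(\bigvee X) = \bigvee(aX)$ and $(\bigvee X)a = \bigvee(Xa)$ for every $a \in Q$ and every nonempty subset $X$ of $Q$ that is finite or bounded above. A closure operation on a poset is a self-map $\star: x \mapsto x^\star$ that is expansive ($x \le x^\star$), order-preserving and idempotent. A nucleus on an ordered magma $M$ is a closure operation $\star$ on $M$ with $x^\star y^\star \le (xy)^\star$ for all $x,y\in M$. A directed subset is a nonempty subset $\Delta$ in which every finite subset has an upper bound in $\Delta$. A closure operation $\star$ on a poset $S$ is finitary if $(\bigvee \Delta)^\star = \bigvee(\Delta^\star)$ for all directed $\Delta \subseteq S$ for which $\bigvee\Delta$ exists, where $\Delta^\star=\{x^\star: x\in\Delta\}$. Self-maps are compared pointwise: $\star_1 \le \star_2$ ("$\star_1$ is smaller than $\star_2$", not necessarily strictly) iff $x^{\star_1} \le x^{\star_2}$ for all $x$. An element $x$ of a poset $S$ is compact if, whenever $x \le \bigvee\Delta$ for a directed subset $\Delta$ of $S$ for which $\bigvee\Delta$ exists, one has $x \le y$ for some $y \in \Delta$; $\mathsf{K}(S)$ is the set of compact elements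 of $S$. An ordered magma $M$ is precoherent if every element of $M$ is the supremum of a set of compact elements of $M$ and $\mathsf{K}(M)$ is closed under multiplication. *)

theory Defs
  imports Main
begin

text \<open>
  The order carries no suprema operator: every equation \<open>\<Or>X = s\<close> is rendered as
  \<open>is_supremum X s\<close>, which includes the existence of the supremum. The set \<open>X\<close>
  may be empty, in which case \<open>s\<close> is the least element.
\<close>

definition (in order) is_supremum :: "'a set \<Rightarrow> 'a \<Rightarrow> bool" where
  "is_supremum X s \<longleftrightarrow> (\<forall>x\<in>X. x \<le> s) \<and> (\<forall>b. (\<forall>x\<in>X. x \<le> b) \<longrightarrow> s \<le> b)"

definition (in order) directed :: "'a set \<Rightarrow> bool" where
  "directed D \<longleftrightarrow> D \<noteq> {} \<and> (\<forall>F. finite F \<and> F \<subseteq> D \<longrightarrow> (\<exists>u\<in>D. \<forall>x\<in>F. x \<le> u))"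

definition (in order) compact_elements :: "'a set" where
  "compact_elements =
    {x. \<forall>D s. directed D \<and> is_supremum D s \<and> x \<le> s \<longrightarrow> (\<exists>y\<in>D. x \<le> y)}"

class ordered_magma = times + order +
  assumes magma_mult_mono: "x \<le> x' \<Longrightarrow> y \<le> y' \<Longrightarrow> x * y \<le> x' * y'"

class semiprequantale = ordered_magma +
  assumes ex_supremum_distrib:
    "X \<noteq> {} \<Longrightarrow> finite X \<or> bdd_above X \<Longrightarrow>
      \<exists>s. is_supremum X s \<and>
        (\<forall>a. is_supremum ((\<lambda>x. a * x) ` X) (a * s) \<and>
             is_supremum ((\<lambda>x. x * a) ` X) (s * a))"

class precoherent_magma = ordered_magma +
  assumes supremum_of_compact_elements: "\<exists>X. X \<subseteq> compact_elements \<and> is_supremum X x"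
    and compact_elements_mult:
      "x \<in> compact_elements \<Longrightarrow> y \<in> compact_elements \<Longrightarrow> x * y \<in> compact_elements"

definition closure_operation :: "('a::order \<Rightarrow> 'a) \<Rightarrow> bool" where
  "closure_operation c \<longleftrightarrow> (\<forall>x. x \<le> c x) \<and> mono c \<and> (\<forall>x. c (c x) = c x)"

definition nucleus :: "('a::ordered_magma \<Rightarrow> 'a) \<Rightarrow> bool" where
  "nucleus c \<longleftrightarrow> closure_operation c \<and> (\<forall>x y. c x * c y \<le> c (x * y))"

definition finitary :: "('a::order \<Rightarrow> 'a) \<Rightarrow> bool" where
  "finitary c \<longleftrightarrow> (\<forall>D s. directed D \<and> is_supremum D s \<longrightarrow> is_supremum (c ` D) (c s))"

end

theory Submission
  imports Defs
begin

text \<open>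
  The compact elements below \<open>x\<close> form a directed set with supremum \<open>x\<close>, and so their images
  under a monotone map form a directed set as well. Hence a compact element below
  the supremum \<open>x\<^sup>f\<close> of all \<open>y\<^sup>\<star>\<close>, \<open>y \<le> x\<close> compact, is already below one such \<open>y\<^sup>\<star>\<close>; this gives
  idempotence. Distributivity over suprema together with closure of the compact elements
  under products gives the nucleus inequality, and a finitary map is determined by its values
  on compact elements, which gives maximality.
\<close>

lemma is_supremum_upper: "is_supremum X s \<Longrightarrow> x \<in> X \<Longrightarrow> x \<le> s"
  by (simp add: is_supremum_def)

lemma is_supremum_least: "is_supremum X s \<Longrightarrow> (\<And>x. x \<in> X \<Longrightarrow> x \<le> b) \<Longrightarrow> s \<le> b"
  by (simp add: is_supremum_def)

lemma is_supremumI: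
  "(\<And>x. x \<in> X \<Longrightarrow> x \<le> s) \<Longrightarrow> (\<And>b. (\<And>x. x \<in> X \<Longrightarrow> x \<le> b) \<Longrightarrow> s \<le> b) \<Longrightarrow> is_supremum X s"
  by (simp add: is_supremum_def)

text \<open>Induction on the finite subset: an upper bound of \<open>F\<close> and the new element
  \<open>a\<close> have a common bound in \<open>D\<close>. Nonemptiness of \<open>D\<close>
  supplies the bound for the empty subset.\<close>

lemma directedI:
  assumes "D \<noteq> {}" and "\<And>x y. x \<in> D \<Longrightarrow> y \<in> D \<Longrightarrow> \<exists>z\<in>D. x \<le> z \<and> y \<le> z"
  shows "directed D"
proof -
  have "\<exists>u\<in>D. \<forall>x\<in>F. x \<le> u" if "finite F" "F \<subseteq> D" for F
    using that
  proof (induction F rule: finite_induct)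
    case empty
    then show ?case using assms(1) by blast
  next
    case (insert a F)
    then obtain u where u: "u \<in> D" "\<forall>x\<in>F. x \<le> u" by auto
    obtain z where "z \<in> D" "a \<le> z" "u \<le> z"
      using assms(2)[of a u] insert.prems u(1) by auto
    with u(2) show ?case by (auto intro: order_trans)
  qed
  with assms(1) show ?thesis by (simp add: directed_def)
qed

lemma directed_image_mono:
  assumes D: "directed D" and f: "mono f"
  shows "directed (f ` D)"
proof (rule directedI)
  show "f ` D \<noteq> {}" using D by (simp add: directed_def)
next
  fix a b assume "a \<in> f ` D" "b \<in> f ` D"
  then obtain x y where xy: "x \<in> D" "y \<in> D" "a = f x" "b = f y" by blast
  moreover have "finite {x, y} \<and> {x, y} \<subseteq> D" using xy by simp
  then obtain u where "u \<in> D" "\<forall>z\<in>{x, y}. z \<le> u" using D unfolding directed_def by blast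
  ultimately show "\<exists>z\<in>f ` D. a \<le> z \<and> b \<le> z" using f by (auto dest: monoD)
qed

lemma compact_elementsD:
  "k \<in> compact_elements \<Longrightarrow> directed D \<Longrightarrow> is_supremum D s \<Longrightarrow> k \<le> s \<Longrightarrow> \<exists>y\<in>D. k \<le> y"
  unfolding compact_elements_def by blast

text \<open>Compactness puts \<open>k\<close> and \<open>l\<close> below two members of
  \<open>D\<close>; a common upper bound of these in \<open>D\<close> is an upper bound of
  \<open>{k, l}\<close>, hence lies above \<open>s\<close>.\<close>

lemma compact_elements_supremum_pair:
  assumes k: "k \<in> compact_elements" and l: "l \<in> compact_elements" and s: "is_supremum {k, l} s"
  shows "s \<in> compact_elements"
proof -
  have "\<exists>y\<in>D. s \<le> y" if D: "directed D" "is_supremum D t" "s \<le> t" for D t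
  proof -
    have "k \<le> t" "l \<le> t"
      using is_supremum_upper[OF s] D(3) by (auto intro: order_trans)
    then obtain x y where xy: "x \<in> D" "k \<le> x" "y \<in> D" "l \<le> y"
      using compact_elementsD[OF k D(1,2)] compact_elementsD[OF l D(1,2)] by blast
    have "finite {x, y} \<and> {x, y} \<subseteq> D" using xy by simp
    then obtain u where u: "u \<in> D" "\<forall>z\<in>{x, y}. z \<le> u"
      using D(1) unfolding directed_def by blast
    have "s \<le> u" using s by (rule is_supremum_least) (use xy u in \<open>auto intro: order_trans\<close>)
    with u(1) show ?thesis by blast
  qed
  then show ?thesis unfolding compact_elements_def by blast
qed

text \<open>Directed sets are nonempty, so any member is a witness. This covers an element that is
  the supremum of the empty set of compact elements.\<close>

lemma least_in_compact_elements:
  assumes "\<And>y. x \<le> y"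
  shows "x \<in> compact_elements"
  using assms by (auto simp: compact_elements_def directed_def)

definition compacts_below :: "'a::order \<Rightarrow> 'a set" where
  "compacts_below x = {y \<in> compact_elements. y \<le> x}"

lemma is_supremum_compacts_below:
  fixes x :: "'a::precoherent_magma"
  shows "is_supremum (compacts_below x) x"
proof -
  obtain X where X: "X \<subseteq> compact_elements" "is_supremum X x"
    using supremum_of_compact_elements by blast
  \<comment> \<open>Enlarging \<open>X\<close> to all compact elements below \<open>x\<close> keeps
    \<open>x\<close> as an upper bound, so the supremum does not change.\<close>
  then have "X \<subseteq> compacts_below x"
    by (auto simp: compacts_below_def dest: is_supremum_upper)
  then show ?thesis
    using is_supremum_least[OF X(2)] by (intro is_supremumI) (auto simp: compacts_below_def)
qed

text \<open>If no compact element were below \<open>x\<close>, then \<open>x\<close> would be the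
  supremum of the empty set, thus least, thus itself compact.\<close>

lemma compacts_below_nonempty:
  fixes x :: "'a::precoherent_magma"
  shows "compacts_below x \<noteq> {}"
proof
  assume e: "compacts_below x = {}"
  then have "x \<le> y" for y
    using is_supremum_compacts_below[of x] by (simp add: is_supremum_def)
  then have "x \<in> compacts_below x"
    by (simp add: compacts_below_def least_in_compact_elements)
  with e show False by simp
qed

lemma directed_compacts_below:
  fixes x :: "'a::{semiprequantale, precoherent_magma}"
  shows "directed (compacts_below x)"
proof (rule directedI[OF compacts_below_nonempty])
  fix k l assume kl: "k \<in> compacts_below x" "l \<in> compacts_below x"
  obtain s where s: "is_supremum {k, l} s"
    using ex_supremum_distrib[of "{k, l}"] by auto
  have "s \<in> compacts_below x"
    using kl compact_elements_supremum_pair[OF _ _ s] is_supremum_least[OF s]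
    by (auto simp: compacts_below_def)
  then show "\<exists>z\<in>compacts_below x. k \<le> z \<and> l \<le> z"
    using is_supremum_upper[OF s] by auto
qed

text \<open>The candidate for the largest finitary nucleus below \<open>c\<close>. The choice
  operator stands in for a supremum operator; the chosen value is meaningful once the supremum is
  known to exist.\<close>

definition finitary_part :: "('a::order \<Rightarrow> 'a) \<Rightarrow> 'a \<Rightarrow> 'a" where
  "finitary_part c x = (SOME s. is_supremum (c ` compacts_below x) s)"

lemma is_supremum_finitary_part:
  fixes c :: "'a::{semiprequantale, precoherent_magma} \<Rightarrow> 'a"
  assumes "mono c"
  shows "is_supremum (c ` compacts_below x) (finitary_part c x)"
proof -
  \<comment> \<open>Monotonicity makes \<open>c x\<close> a bound, so the completeness axiom for
    nonempty bounded sets applies.\<close>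
  have "bdd_above (c ` compacts_below x)"
    using assms by (intro bdd_aboveI[of _ "c x"]) (auto simp: compacts_below_def dest: monoD)
  then have "\<exists>s. is_supremum (c ` compacts_below x) s"
    using ex_supremum_distrib[of "c ` compacts_below x"] compacts_below_nonempty[of x] by blast
  then show ?thesis unfolding finitary_part_def by (rule someI_ex)
qed

lemma finitary_part_upper:
  fixes c :: "'a::{semiprequantale, precoherent_magma} \<Rightarrow> 'a"
  assumes "mono c" and "k \<in> compacts_below x"
  shows "c k \<le> finitary_part c x"
  using is_supremum_upper[OF is_supremum_finitary_part[OF assms(1)]] assms(2) by blast

lemma finitary_part_least:
  fixes c :: "'a::{semiprequantale, precoherent_magma} \<Rightarrow> 'a"
  assumes "mono c" and "\<And>k. k \<in> compacts_below x \<Longrightarrow> c k \<le> b"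
  shows "finitary_part c x \<le> b"
  using is_supremum_least[OF is_supremum_finitary_part[OF assms(1)]] assms(2) by blast

lemma mono_finitary_part:
  fixes c :: "'a::{semiprequantale, precoherent_magma} \<Rightarrow> 'a"
  assumes c: "mono c"
  shows "mono (finitary_part c)"
proof (rule monoI)
  fix x y :: 'a assume "x \<le> y"
  then show "finitary_part c x \<le> finitary_part c y"
    by (intro finitary_part_least[OF c] finitary_part_upper[OF c])
      (auto simp: compacts_below_def)
qed

lemma finitary_part_le:
  fixes c :: "'a::{semiprequantale, precoherent_magma} \<Rightarrow> 'a"
  assumes c: "mono c"
  shows "finitary_part c \<le> c"
  by (intro le_funI finitary_part_least[OF c] monoD[OF c]) (simp add: compacts_below_def)

text \<open>A compact element below the supremum of a directed \<open>D\<close> is already below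
  some \<open>d\<close> in \<open>D\<close>, so every \<open>c k\<close> that contributes to the
  value at \<open>s\<close> also contributes to the value at such a \<open>d\<close>.\<close>

lemma finitary_finitary_part:
  fixes c :: "'a::{semiprequantale, precoherent_magma} \<Rightarrow> 'a"
  assumes c: "mono c"
  shows "finitary (finitary_part c)"
  unfolding finitary_def
proof (intro allI impI, elim conjE)
  fix D and s :: 'a assume D: "directed D" "is_supremum D s"
  show "is_supremum (finitary_part c ` D) (finitary_part c s)"
  proof (rule is_supremumI)
    fix x assume "x \<in> finitary_part c ` D"
    then show "x \<le> finitary_part c s"
      using is_supremum_upper[OF D(2)] monoD[OF mono_finitary_part[OF c]] by blast
  next
    fix b assume b: "\<And>x. x \<in> finitary_part c ` D \<Longrightarrow> x \<le> b"
    show "finitary_part c s \<le> b"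
    proof (rule finitary_part_least[OF c])
      fix k assume k: "k \<in> compacts_below s"
      then obtain d where d: "d \<in> D" "k \<le> d"
        using compact_elementsD[OF _ D] by (auto simp: compacts_below_def)
      have "c k \<le> finitary_part c d"
        using k d by (intro finitary_part_upper[OF c]) (simp add: compacts_below_def)
      also have "\<dots> \<le> b" using b d(1) by blast
      finally show "c k \<le> b" .
    qed
  qed
qed

lemma finitary_le_finitary_part:
  fixes c g :: "'a::{semiprequantale, precoherent_magma} \<Rightarrow> 'a"
  assumes c: "mono c" and g: "finitary g" "g \<le> c"
  shows "g \<le> finitary_part c"
proof (rule le_funI)
  fix x :: 'a
  \<comment> \<open>Finitarity is applied to the directed set \<open>compacts_below x\<close>, whose
    supremum is \<open>x\<close>.\<close>
  have "is_supremum (g ` compacts_below x) (g x)"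
    using g(1) directed_compacts_below is_supremum_compacts_below by (auto simp: finitary_def)
  then show "g x \<le> finitary_part c x"
  proof (rule is_supremum_least)
    fix z assume "z \<in> g ` compacts_below x"
    then obtain k where k: "k \<in> compacts_below x" "z = g k" by blast
    have "g k \<le> c k" using g(2) by (rule le_funD)
    also have "\<dots> \<le> finitary_part c x" using c k(1) by (rule finitary_part_upper)
    finally show "z \<le> finitary_part c x" using k(2) by simp
  qed
qed

lemma closure_operation_finitary_part:
  fixes c :: "'a::{semiprequantale, precoherent_magma} \<Rightarrow> 'a"
  assumes "closure_operation c"
  shows "closure_operation (finitary_part c)"
proof -
  have c: "mono c" and expansive: "x \<le> c x" and idem: "c (c x) = c x" for x
    using assms by (auto simp: closure_operation_def)
  have le: "x \<le> finitary_part c x" for x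
    using is_supremum_compacts_below
    by (rule is_supremum_least) (meson expansive finitary_part_upper[OF c] order_trans)
  have "finitary_part c (finitary_part c x) \<le> finitary_part c x" for x
  proof (rule finitary_part_least[OF c])
    fix k assume "k \<in> compacts_below (finitary_part c x)"
    then obtain y where y: "y \<in> compacts_below x" "k \<le> c y"
      using compact_elementsD[OF _ directed_image_mono[OF directed_compacts_below c]
          is_supremum_finitary_part[OF c]]
      by (auto simp: compacts_below_def)
    have "c k \<le> c y" using monoD[OF c y(2)] by (simp add: idem)
    also have "\<dots> \<le> finitary_part c x" using c y(1) by (rule finitary_part_upper)
    finally show "c k \<le> finitary_part c x" .
  qed
  then show ?thesis
    using le mono_finitary_part[OF c] by (auto simp: closure_operation_def intro: order.antisym)
qed

text \<open>Distributivity is used one factor at a time: first \<open>x * t\<close> is the supremum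
  of the \<open>x * y\<close>, then \<open>s * t\<close> is the supremum of the
  \<open>x * t\<close>.\<close>

lemma is_supremum_mult_le:
  fixes s t b :: "'a::semiprequantale"
  assumes X: "is_supremum X s" "X \<noteq> {}" and Y: "is_supremum Y t" "Y \<noteq> {}"
    and b: "\<And>x y. x \<in> X \<Longrightarrow> y \<in> Y \<Longrightarrow> x * y \<le> b"
  shows "s * t \<le> b"
proof -
  \<comment> \<open>The class axiom yields some distributive supremum \<open>v\<close>; uniqueness
    of suprema identifies it with the given \<open>u\<close>, which also serves as the bound the
    axiom asks for.\<close>
  have distrib: "is_supremum ((\<lambda>x. a * x) ` Z) (a * u) \<and> is_supremum ((\<lambda>x. x * a) ` Z) (u * a)"
    if Z: "is_supremum Z u" "Z \<noteq> {}" for Z and u a :: 'a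
  proof -
    have "bdd_above Z" using is_supremum_upper[OF Z(1)] by (rule bdd_aboveI)
    then obtain v where v: "is_supremum Z v"
      "\<forall>a. is_supremum ((\<lambda>x. a * x) ` Z) (a * v) \<and> is_supremum ((\<lambda>x. x * a) ` Z) (v * a)"
      using ex_supremum_distrib[OF Z(2)] by blast
    have "v = u" using v(1) Z(1) by (auto simp: is_supremum_def intro: order.antisym)
    with v(2) show ?thesis by simp
  qed
  have "x * t \<le> b" if "x \<in> X" for x
    by (rule is_supremum_least[OF conjunct1[OF distrib[OF Y]]]) (use b that in auto)
  then show ?thesis
    by (intro is_supremum_least[OF conjunct2[OF distrib[OF X]]]) auto
qed

lemma nucleus_finitary_part:
  fixes c :: "'a::{semiprequantale, precoherent_magma} \<Rightarrow> 'a"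
  assumes "nucleus c"
  shows "nucleus (finitary_part c)"
proof -
  have cl: "closure_operation c" and c: "mono c" and mult: "c x * c y \<le> c (x * y)" for x y
    using assms by (auto simp: nucleus_def closure_operation_def)
  have "finitary_part c x * finitary_part c y \<le> finitary_part c (x * y)" for x y
  proof (rule is_supremum_mult_le[OF is_supremum_finitary_part[OF c] _
        is_supremum_finitary_part[OF c]])
    fix u v assume "u \<in> c ` compacts_below x" "v \<in> c ` compacts_below y"
    then obtain k l where kl: "k \<in> compacts_below x" "l \<in> compacts_below y"
      "u = c k" "v = c l" by blast
    \<comment> \<open>Closure of the compact elements under products enters here, so that
      \<open>c (k * l)\<close> is among the elements whose supremum is the value at
      \<open>x * y\<close>.\<close>
    have "k * l \<in> compacts_below (x * y)"
      using kl(1,2) by (simp add: compacts_below_def compact_elements_mult magma_mult_mono)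
    then show "u * v \<le> finitary_part c (x * y)"
      using mult[of k l] finitary_part_upper[OF c] kl(3,4) by (auto intro: order_trans)
  qed (simp_all add: compacts_below_nonempty)
  then show ?thesis
    using closure_operation_finitary_part[OF cl] by (simp add: nucleus_def)
qed

theorem theorem1p6:
  fixes star :: "'q::{semiprequantale, precoherent_magma} \<Rightarrow> 'q"
  assumes "nucleus star"
  shows "\<exists>star_f :: 'q \<Rightarrow> 'q.
    nucleus star_f \<and> finitary star_f \<and> star_f \<le> star \<and>
    (\<forall>g. nucleus g \<and> finitary g \<and> g \<le> star \<longrightarrow> g \<le> star_f) \<and>
    (\<forall>x. is_supremum {star y |y. y \<in> compact_elements \<and> y \<le> x} (star_f x))"
proof -
  have star: "mono star" using assms by (simp add: nucleus_def closure_operation_def)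
  have "{star y |y. y \<in> compact_elements \<and> y \<le> x} = star ` compacts_below x" for x
    by (auto simp: compacts_below_def)
  then show ?thesis
    using nucleus_finitary_part[OF assms] finitary_finitary_part[OF star]
      finitary_part_le[OF star] finitary_le_finitary_part[OF star]
      is_supremum_finitary_part[OF star]
    by (intro exI[of _ "finitary_part star"]) simp
qed

end
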